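(* Let $U\subset\mathbb R^n$ ($n\ge2$) be a bounded domain with $C^1$ boundary $\Gamma$, let $\gamma_1,\gamma_2>0$ be two functions on $U$, and let $r,q$ be numbers with $r>2$ and $r>q\ge1$. Suppose $\mathring X^{r,q}_{\gamma_1,\gamma_2}(U)$ is a class of functions on $U$ vanishing on $\Gamma$ and $c_0>0$ is a constant such that $$\|u\|_{L^r_{\gamma_1}(U)}\le c_0\|\nabla u\|_{L^q_{\gamma_2}(U)}\quad\text{for all }u\in\mathring X^{r,q}_{\gamma_1,\gamma_2}(U).$$ Let $m$ be a number in $(q,r)$ and define $$p=2+m\Big(1-\frac2r\Big).$$ Then for any $T>0$, any function $F(x,t)>0$ on $Q_T$, and any $u(x,t)\in\mathring X^{r,q}_{\gamma_1,\gamma_2}(Q_T)$, one has $$\|u\|_{L^p_{\gamma_1}(Q_T)}\le c_0^{\frac mp}\,\mathcal Z^{\frac{m-q}{pq}}\Big(\operatorname*{ess\,sup}_{0<t<T}\|u(t)\|_{L^2_{\gamma_1}(U)}+\|\nabla u\|_{L^m_F(Q_T)}\Big),$$ where $$\mathcal Z=\operatorname*{ess\,sup}_{0<t<T}\Big(\int_U\gamma_2(x)^{\frac m{m-q}}F(x,t)^{-\frac q{m-q}}\chi_{\operatorname{supp}u}(x,t)\,dx\Big).$$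
   Context: $Q_T=U\times(0,T)$, $u(t)=u(\cdot,t)$, $\nabla$ is the spatial gradient, and $\chi_{\operatorname{supp}u}$ is the characteristic function of the support of $u$. $\mathring X^{r,q}_{\gamma_1,\gamma_2}(Q_T)$ denotes the set of functions $u(x,t)$ such that $u(\cdot,t)\in\mathring X^{r,q}_{\gamma_1,\gamma_2}(U)$ for almost all $t\in(0,T)$. For a weight $f\ge0$ on $U$, $L^s_f(U)$ is the $L^s$ space on $U$ with respect to the measure $f(x)\,dx$; for a weight $f$ on $U$ or on $U\times\mathbb R$ and $E\subset U\times\mathbb R$, $L^s_f(E)$ is the $L^s$ space on $E$ with respect to the measure $f\,dx\,dt$. *)

theory Defs
  imports "HOL-Analysis.Analysis" "HOL-Probability.Essential_Supremum"
begin

definition C1_function :: "('a::euclidean_space \<Rightarrow> real) \<Rightarrow> bool" where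
  "C1_function f \<longleftrightarrow>
     (\<forall>x. f differentiable (at x)) \<and>
     (\<forall>v. continuous_on UNIV (\<lambda>x. frechet_derivative f (at x) v))"

text \<open>
  Near each boundary point, \<open>U\<close> is the region above the graph of a \<open>C\<^sup>1\<close> function, after a
  rotation.  The unit vector \<open>e\<close> is the vertical direction; \<open>h\<close> is evaluated only on the hyperplane
  orthogonal to \<open>e\<close>, and every \<open>C\<^sup>1\<close> function on that hyperplane extends to the whole space by
  composition with the orthogonal projection.
\<close>
definition C1_boundary :: "'a::euclidean_space set \<Rightarrow> bool" where
  "C1_boundary U \<longleftrightarrow>
     (\<forall>x0 \<in> frontier U. \<exists>\<rho> e h. \<rho> > 0 \<and> norm e = 1 \<and> C1_function h \<and>
        U \<inter> ball x0 \<rho> = {x \<in> ball x0 \<rho>. x \<bullet> e > h (x - (x \<bullet> e) *\<^sub>R e)})"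

definition bounded_C1_domain :: "'a::euclidean_space set \<Rightarrow> bool" where
  "bounded_C1_domain U \<longleftrightarrow>
     open U \<and> connected U \<and> U \<noteq> {} \<and> bounded U \<and> C1_boundary U"

definition locally_integrable ::
    "'a::euclidean_space set \<Rightarrow> ('a \<Rightarrow> 'b::euclidean_space) \<Rightarrow> bool" where
  "locally_integrable U f \<longleftrightarrow> (\<forall>K. compact K \<and> K \<subseteq> U \<longrightarrow> set_integrable lebesgue K f)"

text \<open>
  \<open>g\<close> is a representative of the weak gradient of \<open>u\<close> on \<open>U\<close>.  Test functions are compactly supported
  and \<open>C\<^sup>1\<close>, as in Gilbarg and Trudinger; by mollification, smooth test functions give the same notion.
\<close>
definition weak_gradient ::
    "(real^'n) set \<Rightarrow> (real^'n \<Rightarrow> real) \<Rightarrow> (real^'n \<Rightarrow> real^'n) \<Rightarrow> bool" where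
  "weak_gradient U u g \<longleftrightarrow>
     locally_integrable U u \<and> locally_integrable U g \<and>
     (\<forall>\<phi> i. C1_function \<phi> \<and> compact (closure {x. \<phi> x \<noteq> 0}) \<and> closure {x. \<phi> x \<noteq> 0} \<subseteq> U \<longrightarrow>
        (LINT x|lebesgue_on U. u x * frechet_derivative \<phi> (at x) (axis i 1)) =
        - (LINT x|lebesgue_on U. g x $ i * \<phi> x))"

text \<open>
  Sets of zero \<open>(d - 1)\<close>-dimensional Hausdorff measure in dimension \<open>d \<ge> 2\<close>.  The covering radii need
  no separate bound, since a small sum already forces each of them to be small.
\<close>
definition surface_null :: "'a::euclidean_space set \<Rightarrow> bool" where
  "surface_null N \<longleftrightarrow>
     (\<forall>\<epsilon>>0. \<exists>(c :: nat \<Rightarrow> 'a) \<rho>. (\<forall>k. \<rho> k \<ge> 0) \<and> N \<subseteq> (\<Union>k. ball (c k) (\<rho> k)) \<and>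
        (\<Sum>k. ennreal (\<rho> k ^ (DIM('a) - 1))) < ennreal \<epsilon>)"

text \<open>
  \<open>u = 0\<close> on the boundary of \<open>U\<close> in the sense of traces: at surface-almost every boundary point the
  averages of \<open>\<bar>u\<bar>\<close> over \<open>U \<inter> B(x, \<rho>)\<close> tend to \<open>0\<close>.  On a bounded \<open>C\<^sup>1\<close> domain this is the usual zero
  trace for \<open>u\<close> in \<open>W\<^sup>1\<^sup>,\<^sup>1(U)\<close> (Evans and Gariepy), and it holds whenever \<open>u(y)\<close> tends to \<open>0\<close> as
  \<open>y\<close> tends to the boundary; integrability of the gradient up to the boundary is not needed.
\<close>
definition vanishes_on_boundary :: "'a::euclidean_space set \<Rightarrow> ('a \<Rightarrow> real) \<Rightarrow> bool" where
  "vanishes_on_boundary U u \<longleftrightarrow>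
     (\<exists>N. surface_null N \<and>
        (\<forall>x \<in> frontier U - N.
           ((\<lambda>\<rho>. (\<integral>\<^sup>+y\<in>U \<inter> ball x \<rho>. ennreal \<bar>u y\<bar> \<partial>lebesgue) / emeasure lebesgue (U \<inter> ball x \<rho>))
              \<longlongrightarrow> 0) (at_right 0)))"

text \<open>Extended-valued powers; used only with exponents \<open>a > 0\<close>, where \<open>0\<close> has power \<open>0\<close>.\<close>
definition ennpowr :: "ennreal \<Rightarrow> real \<Rightarrow> ennreal" where
  "ennpowr x a = (if x = top then top else ennreal (enn2real x powr a))"

text \<open>
  The norm of \<open>L\<^sup>s\<close> on \<open>E\<close> with respect to the measure with Lebesgue density \<open>f\<close>; it is infinite when
  \<open>u\<close> is not in the space.
\<close>
definition wnorm ::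
    "real \<Rightarrow> ('a::euclidean_space \<Rightarrow> real) \<Rightarrow> 'a set \<Rightarrow> ('a \<Rightarrow> 'b::real_normed_vector) \<Rightarrow> ennreal" where
  "wnorm s f E u =
     ennpowr (\<integral>\<^sup>+x. ennreal (norm (u x) powr s) \<partial>density (lebesgue_on E) (\<lambda>x. ennreal (f x))) (1 / s)"

definition spacetime :: "'a set \<Rightarrow> real \<Rightarrow> ('a \<times> real) set" where
  "spacetime U T = U \<times> {0<..<T}"

text \<open>
  Members of a class of functions on \<open>U\<close> are total functions; their values outside \<open>U\<close> play no role
  (a class on \<open>U\<close> corresponds to the set of all total functions with restriction in the class).
\<close>
definition spacetime_class :: "('a \<Rightarrow> real) set \<Rightarrow> real \<Rightarrow> ('a \<times> real \<Rightarrow> real) set" where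
  "spacetime_class X T = {u. AE t in lebesgue_on {0<..<T}. (\<lambda>x. u (x, t)) \<in> X}"

text \<open>\<open>Du\<close> is a jointly measurable representative of the weak gradient of \<open>u\<close> in the space variable.\<close>
definition spatial_gradient ::
    "(real^'n) set \<Rightarrow> real \<Rightarrow> ((real^'n) \<times> real \<Rightarrow> real) \<Rightarrow> ((real^'n) \<times> real \<Rightarrow> real^'n) \<Rightarrow> bool" where
  "spatial_gradient U T u Du \<longleftrightarrow>
     Du \<in> borel_measurable (lebesgue_on (spacetime U T)) \<and>
     (AE t in lebesgue_on {0<..<T}. weak_gradient U (\<lambda>x. u (x, t)) (\<lambda>x. Du (x, t)))"

definition supp_in :: "'a::topological_space set \<Rightarrow> ('a \<Rightarrow> real) \<Rightarrow> 'a set" where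
  "supp_in Q u = Q \<inter> closure {z \<in> Q. u z \<noteq> 0}"

definition Z_const ::
    "(real^'n) set \<Rightarrow> real \<Rightarrow> real \<Rightarrow> real \<Rightarrow> (real^'n \<Rightarrow> real) \<Rightarrow> ((real^'n) \<times> real \<Rightarrow> real) \<Rightarrow>
     ((real^'n) \<times> real \<Rightarrow> real) \<Rightarrow> ennreal" where
  "Z_const U T m q \<gamma>2 F u =
     esssup (lebesgue_on {0<..<T})
       (\<lambda>t. \<integral>\<^sup>+x. ennreal (\<gamma>2 x powr (m / (m - q)) * F (x, t) powr (- (q / (m - q))) *
                         indicator (supp_in (spacetime U T) u) (x, t)) \<partial>lebesgue_on U)"

end

theory Submission
  imports Defs
begin

text \<open>
  Everything happens on one time slice. Write \<open>v = u(t)\<close>. Hoelder's inequality between \<open>L\<^sup>r\<close> and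
  \<open>L\<^sup>2\<close> with exponent \<open>\<theta> = m/r\<close> bounds \<open>\<integral> \<gamma>\<^sub>1 |v|\<^sup>p\<close> by \<open>\<parallel>v\<parallel>\<^sub>r\<^sup>m \<parallel>v\<parallel>\<^sub>2\<^bsup>p-m\<^esup>\<close>: the value of \<open>p\<close> is the one
  for which \<open>p = r \<theta> + 2 (1 - \<theta>)\<close> (\<open>nn_integral_interpolation\<close>). The assumed inequality turns
  \<open>\<parallel>v\<parallel>\<^sub>r\<close> into \<open>c\<^sub>0 \<parallel>\<nabla>v\<parallel>\<^sub>q\<close>, and a second use of Hoelder's inequality exchanges the weight \<open>\<gamma>\<^sub>2\<close>, with
  exponent \<open>q\<close>, for the weight \<open>F\<close>, with exponent \<open>m\<close>, at the price of \<open>Z\<close> (\<open>wnorm_weight_change\<close>).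
  The choice of \<open>\<theta>\<close> makes \<open>\<parallel>\<nabla>v\<parallel>\<close> appear with the power \<open>m\<close>, so the slice estimate is linear in
  \<open>\<integral> F |\<nabla>v|\<^sup>m\<close> and can be integrated in \<open>t\<close> with the other factors replaced by essential suprema. The
  \<open>p\<close>-th root gives a product \<open>S\<^bsup>(p-m)/p\<^esup> G\<^bsup>m/p\<^esup>\<close> of two norms, which is at most \<open>S + G\<close> because the
  exponents add up to \<open>1\<close>.

  Two points need care. First, the cut-off in \<open>Z\<close> refers to the support of \<open>u\<close> in space-time, while
  the integral to be estimated contains \<open>\<nabla>u(t)\<close>; on the slice the complement of that support is an
  open set on which \<open>u(t)\<close> is zero, and a weak gradient is zero almost everywhere there
  (\<open>weak_gradient_vanishes\<close>, from the fundamental lemma of the calculus of variations). Second,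
  measurability is Lebesgue measurability on the product, so slices are measurable only for almost
  every \<open>t\<close>, and Tonelli's theorem is obtained through Borel representatives
  (\<open>Tonelli_lebesgue_on\<close>).

  Norms and \<open>Z\<close> may be infinite. All the power laws used hold on the extended half-line with
  \<open>0 \<cdot> \<infinity> = 0\<close>, and so does Hoelder's inequality, since a zero factor forces the integrand to vanish
  almost everywhere. Hence degenerate values need no separate treatment after that.
\<close>

section \<open>Powers of extended nonnegative numbers\<close>

lemma ennpowr_ennreal: "x \<ge> 0 \<Longrightarrow> ennpowr (ennreal x) a = ennreal (x powr a)"
  by (simp add: ennpowr_def)

lemma ennpowr_0 [simp]: "ennpowr 0 a = 0"
  by (simp add: ennpowr_def)

lemma ennpowr_top [simp]: "ennpowr top a = top"
  by (simp add: ennpowr_def)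

lemma ennpowr_1 [simp]: "ennpowr x 1 = x"
  by (cases x) (simp_all add: ennpowr_ennreal)

lemma ennpowr_ennpowr: "ennpowr (ennpowr x a) b = ennpowr x (a * b)"
  by (cases x) (simp_all add: ennpowr_ennreal powr_powr)

lemma ennpowr_add: "ennpowr x (a + b) = ennpowr x a * ennpowr x b"
  by (cases x) (simp_all add: ennpowr_ennreal powr_add ennreal_mult)

lemma ennpowr_eq_0_iff [simp]: "ennpowr x a = 0 \<longleftrightarrow> x = 0"
  by (cases x) (simp_all add: ennpowr_ennreal)

lemma ennpowr_mult: "ennpowr (x * y) a = ennpowr x a * ennpowr y a"
proof (cases "x = top \<or> y = top")
  case True
  then show ?thesis
    by (auto simp: ennreal_top_mult ennreal_mult_top)
next
  case False
  then show ?thesis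
    by (cases x; cases y)
      (simp_all add: ennpowr_ennreal powr_mult ennreal_mult[symmetric])
qed

lemma ennpowr_mono:
  assumes "x \<le> y" "a \<ge> 0"
  shows "ennpowr x a \<le> ennpowr y a"
  using assms by (cases x; cases y) (simp_all add: ennpowr_ennreal powr_mono2 top_unique)

section \<open>Hoelder's inequality\<close>

text \<open>
  If both integrals are positive and finite, normalise them to \<open>1\<close> and integrate the weighted
  inequality between the geometric and arithmetic means. If one of them is \<open>0\<close>, the integrand on the
  left is zero almost everywhere, so the bound also holds when the other one is infinite.
\<close>
lemma nn_integral_Holder:
  fixes f g :: "'a \<Rightarrow> real"
  assumes [measurable]: "f \<in> borel_measurable M" "g \<in> borel_measurable M"
    and nonneg: "\<And>x. x \<in> space M \<Longrightarrow> f x \<ge> 0" "\<And>x. x \<in> space M \<Longrightarrow> g x \<ge> 0"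
    and \<theta>: "0 < \<theta>" "\<theta> < 1"
  shows "(\<integral>\<^sup>+x. ennreal (f x powr \<theta> * g x powr (1 - \<theta>)) \<partial>M)
    \<le> ennpowr (\<integral>\<^sup>+x. ennreal (f x) \<partial>M) \<theta> * ennpowr (\<integral>\<^sup>+x. ennreal (g x) \<partial>M) (1 - \<theta>)"
    (is "?L \<le> ennpowr ?A \<theta> * ennpowr ?B (1 - \<theta>)")
proof (cases "?A = 0 \<or> ?B = 0")
  case True
  have "AE x in M. f x = 0 \<or> g x = 0"
    using True
  proof
    assume "?A = 0"
    then have "AE x in M. ennreal (f x) = 0"
      by (subst (asm) nn_integral_0_iff_AE) auto
    then show ?thesis
      using AE_space by eventually_elim (use nonneg in force)
  next
    assume "?B = 0"
    then have "AE x in M. ennreal (g x) = 0"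
      by (subst (asm) nn_integral_0_iff_AE) auto
    then show ?thesis
      using AE_space by eventually_elim (use nonneg in force)
  qed
  then have "?L = (\<integral>\<^sup>+x. 0 \<partial>M)"
    by (intro nn_integral_cong_AE) auto
  then show ?thesis
    by simp
next
  case False
  show ?thesis
  proof (cases "?A = top \<or> ?B = top")
    case True
    then show ?thesis
      using False by (auto simp: ennreal_top_mult ennreal_mult_top)
  next
    case fin: False
    then obtain a b where a: "?A = ennreal a" "a \<ge> 0" and b: "?B = ennreal b" "b \<ge> 0"
      by (metis ennreal_cases)
    then have pos: "a > 0" "b > 0"
      using False by (auto simp: less_le)
    define c where "c = a powr \<theta> * b powr (1 - \<theta>)"
    have "c > 0"
      using pos by (simp add: c_def)
    have pointwise: "f x powr \<theta> * g x powr (1 - \<theta>)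
        \<le> c * \<theta> / a * f x + c * (1 - \<theta>) / b * g x" if x: "x \<in> space M" for x
    proof (cases "f x = 0 \<or> g x = 0")
      case True
      then show ?thesis
        using nonneg[OF x] \<theta> pos \<open>c > 0\<close> by auto
    next
      case False
      then have "f x > 0" "g x > 0"
        using nonneg[OF x] by auto
      then have "(f x / a) powr \<theta> * (g x / b) powr (1 - \<theta>) \<le> \<theta> * (f x / a) + (1 - \<theta>) * (g x / b)"
        using \<theta> pos by (intro Youngs_inequality_0) auto
      then have "c * ((f x / a) powr \<theta> * (g x / b) powr (1 - \<theta>))
          \<le> c * (\<theta> * (f x / a) + (1 - \<theta>) * (g x / b))"
        using \<open>c > 0\<close> by simp
      moreover have "c * ((f x / a) powr \<theta> * (g x / b) powr (1 - \<theta>)) = f x powr \<theta> * g x powr (1 - \<theta>)"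
        using \<open>f x > 0\<close> \<open>g x > 0\<close> pos by (simp add: c_def powr_divide)
      ultimately show ?thesis
        by (simp add: algebra_simps)
    qed
    have "?L \<le> (\<integral>\<^sup>+x. ennreal (c * \<theta> / a) * ennreal (f x) + ennreal (c * (1 - \<theta>) / b) * ennreal (g x) \<partial>M)"
      using pointwise nonneg \<theta> pos \<open>c > 0\<close>
      by (intro nn_integral_mono)
        (simp add: ennreal_mult[symmetric] ennreal_plus[symmetric] del: ennreal_plus)
    also have "\<dots> = ennreal (c * \<theta> / a) * ennreal a + ennreal (c * (1 - \<theta>) / b) * ennreal b"
      by (simp add: nn_integral_add nn_integral_cmult a b)
    also have "\<dots> = ennreal (c * \<theta> / a * a + c * (1 - \<theta>) / b * b)"
      using pos \<theta> \<open>c > 0\<close>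
      by (simp add: ennreal_mult[symmetric] ennreal_plus[symmetric] del: ennreal_plus)
    also have "c * \<theta> / a * a + c * (1 - \<theta>) / b * b = c"
      using pos by (simp add: field_simps)
    also have "\<dots> = ennpowr ?A \<theta> * ennpowr ?B (1 - \<theta>)"
      using pos by (simp add: a b c_def ennpowr_ennreal ennreal_mult)
    finally show ?thesis .
  qed
qed

section \<open>Tonelli's theorem for the completed Lebesgue measure\<close>

lemma AE_lborel_slices:
  fixes P :: "'a::euclidean_space \<times> 'b::euclidean_space \<Rightarrow> bool"
  assumes "AE z in lborel. P z"
  shows "AE y in lborel. AE x in lborel. P (x, y)"
proof -
  obtain N where N: "N \<in> null_sets (lborel :: ('a \<times> 'b) measure)" "{z. \<not> P z} \<subseteq> N"
    using assms by (auto simp: eventually_ae_filter)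
  have "AE z in lborel. z \<notin> N"
    using N(1) by (rule AE_not_in)
  then have "AE x in lborel. AE y in lborel. (x, y) \<notin> N"
    by (intro lborel_pair.AE_pair) (simp only: lborel_prod)
  moreover have "{z \<in> space (lborel \<Otimes>\<^sub>M lborel). (fst z, snd z) \<notin> N} \<in> sets (lborel \<Otimes>\<^sub>M lborel)"
    using N(1) unfolding lborel_prod by (auto simp: Collect_neg_eq null_sets_def)
  ultimately have "AE y in lborel. AE x in lborel. (x, y) \<notin> N"
    using lborel_pair.AE_commute[of "\<lambda>x y. (x, y) \<notin> N"] by simp
  then show ?thesis
    using N(2) by (auto elim!: eventually_mono)
qed

text \<open>
  Completeness makes measurability insensitive to null sets; this is what carries measurability
  from a Borel representative back to the given function.
\<close>
lemma borel_measurable_completion_cong_AE: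
  fixes f g :: "'a \<Rightarrow> 'b::topological_space"
  assumes "f \<in> borel_measurable M" and "AE x in M. f x = g x"
  shows "g \<in> borel_measurable (completion M)"
proof (rule measurableI)
  fix S :: "'b set" assume "S \<in> sets borel"
  then have S: "f -` S \<inter> space M \<in> sets (completion M)"
    using assms(1) by (auto intro: measurable_sets)
  have "AE x in completion M. x \<in> f -` S \<inter> space M \<longleftrightarrow> x \<in> g -` S \<inter> space M"
    using assms(2) by (intro AE_completion) (auto elim!: eventually_mono)
  then show "g -` S \<inter> space (completion M) \<in> sets (completion M)"
    using completion.in_sets_AE[OF _ S] by auto
qed simp

text \<open>
  Lebesgue measure on a product is the completion of the product measure, not the product of the
  completions. So \<open>h\<close> is replaced by a Borel function \<open>k\<close> that agrees with it almost everywhere. Almost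
  every slice of \<open>h\<close> then agrees almost everywhere with a slice of \<open>k\<close>, and the three claims pass from
  \<open>k\<close> to \<open>h\<close>; the exceptional null set of \<open>y\<close> is why slices are measurable only almost everywhere.
\<close>
lemma Tonelli_lebesgue_on:
  fixes h :: "'a::euclidean_space \<times> 'b::euclidean_space \<Rightarrow> ennreal"
  assumes h: "h \<in> borel_measurable (lebesgue_on (A \<times> B))"
    and A: "A \<in> sets borel" and B: "B \<in> sets borel"
  shows "AE y in lebesgue_on B. (\<lambda>x. h (x, y)) \<in> borel_measurable (lebesgue_on A)"
    and "(\<lambda>y. \<integral>\<^sup>+x. h (x, y) \<partial>lebesgue_on A) \<in> borel_measurable (lebesgue_on B)"
    and "(\<integral>\<^sup>+z. h z \<partial>lebesgue_on (A \<times> B)) = (\<integral>\<^sup>+y. \<integral>\<^sup>+x. h (x, y) \<partial>lebesgue_on A \<partial>lebesgue_on B)"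
proof -
  have AB: "A \<times> B \<in> sets borel"
    using A B by (simp add: borel_prod[symmetric])
  have "(\<lambda>z. h z * indicator (A \<times> B) z) \<in> borel_measurable lebesgue"
    using h AB by (subst (asm) borel_measurable_restrict_space_iff_ennreal) auto
  then obtain k where k: "k \<in> borel_measurable lborel"
      and hk: "AE z in lborel. h z * indicator (A \<times> B) z = k z"
    using completion_ex_borel_measurable by blast
  have k' [measurable]: "k \<in> borel_measurable (lborel \<Otimes>\<^sub>M lborel)"
    using k by (simp add: lborel_prod)
  have slices: "AE y in lborel. AE x in lborel. h (x, y) * indicator A x * indicator B y = k (x, y)"
    using AE_lborel_slices[OF hk] by (simp add: indicator_times mult.assoc)
  have slices': "AE y in lebesgue_on B. AE x in lborel. h (x, y) * indicator A x = k (x, y)"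
    using slices B by (auto simp: AE_restrict_space_iff AE_completion_iff)
  have k_slice: "(\<lambda>x. k (x, y)) \<in> borel_measurable lborel" for y
    by measurable
  have inner: "(\<integral>\<^sup>+x. h (x, y) \<partial>lebesgue_on A) = (\<integral>\<^sup>+x. h (x, y) * indicator A x \<partial>lborel)" for y
    using A by (subst nn_integral_restrict_space) (auto simp: nn_integral_completion)
  show "AE y in lebesgue_on B. (\<lambda>x. h (x, y)) \<in> borel_measurable (lebesgue_on A)"
    using slices'
  proof eventually_elim
    case (elim y)
    have "(\<lambda>x. h (x, y) * indicator A x) \<in> borel_measurable lebesgue"
      using elim by (intro borel_measurable_completion_cong_AE[OF k_slice]) auto
    then show ?case
      using A by (subst borel_measurable_restrict_space_iff_ennreal) auto
  qed
  have slices_int: "AE y in lborel. (\<integral>\<^sup>+x. k (x, y) \<partial>lborel)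
      = (\<integral>\<^sup>+x. h (x, y) * indicator A x \<partial>lborel) * indicator B y"
    using slices
  proof eventually_elim
    case (elim y)
    have "(\<integral>\<^sup>+x. k (x, y) \<partial>lborel)
        = (\<integral>\<^sup>+x. h (x, y) * indicator A x * indicator B y \<partial>lborel)"
      using elim by (intro nn_integral_cong_AE) auto
    then show ?case
      by (cases "y \<in> B") auto
  qed
  have k_inner [measurable]: "(\<lambda>y. \<integral>\<^sup>+x. k (x, y) \<partial>lborel) \<in> borel_measurable lborel"
    by measurable
  show "(\<lambda>y. \<integral>\<^sup>+x. h (x, y) \<partial>lebesgue_on A) \<in> borel_measurable (lebesgue_on B)"
    using borel_measurable_completion_cong_AE[OF k_inner slices_int] B unfolding inner
    by (subst borel_measurable_restrict_space_iff_ennreal) auto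
  have "(\<integral>\<^sup>+z. h z \<partial>lebesgue_on (A \<times> B)) = (\<integral>\<^sup>+z. h z * indicator (A \<times> B) z \<partial>lborel)"
    using AB by (subst nn_integral_restrict_space) (auto simp: nn_integral_completion)
  also have "\<dots> = (\<integral>\<^sup>+z. k z \<partial>(lborel \<Otimes>\<^sub>M lborel))"
    unfolding lborel_prod by (rule nn_integral_cong_AE[OF hk])
  also have "\<dots> = (\<integral>\<^sup>+y. \<integral>\<^sup>+x. k (x, y) \<partial>lborel \<partial>lborel)"
    by (rule lborel_pair.nn_integral_snd[symmetric]) measurable
  also have "\<dots> = (\<integral>\<^sup>+y. (\<integral>\<^sup>+x. h (x, y) * indicator A x \<partial>lborel) * indicator B y \<partial>lborel)"
    using slices_int by (rule nn_integral_cong_AE)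
  also have "\<dots> = (\<integral>\<^sup>+y. \<integral>\<^sup>+x. h (x, y) \<partial>lebesgue_on A \<partial>lebesgue_on B)"
    unfolding inner using B
    by (subst nn_integral_restrict_space) (auto simp: nn_integral_completion)
  finally show "(\<integral>\<^sup>+z. h z \<partial>lebesgue_on (A \<times> B)) = (\<integral>\<^sup>+y. \<integral>\<^sup>+x. h (x, y) \<partial>lebesgue_on A \<partial>lebesgue_on B)" .
qed

text \<open>
  Replace \<open>w\<close> by a Borel representative. The projection pulls the exceptional null set \<open>N\<close> back to
  \<open>N \<times> UNIV\<close>, which is null, and completeness of the Lebesgue measure does the rest.
\<close>
lemma borel_measurable_fst_lebesgue_on:
  fixes w :: "'a::euclidean_space \<Rightarrow> real"
  assumes w: "w \<in> borel_measurable (lebesgue_on A)"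
    and A: "A \<in> sets borel" and B: "B \<in> sets (borel :: 'b::euclidean_space measure)"
  shows "(\<lambda>(x, y). w x) \<in> borel_measurable (lebesgue_on (A \<times> B))"
proof -
  have AB: "A \<times> B \<in> sets borel"
    using A B by (simp add: borel_prod[symmetric])
  have "(\<lambda>x. indicator A x *\<^sub>R w x) \<in> borel_measurable lebesgue"
    using w A by (subst (asm) borel_measurable_restrict_space_iff) auto
  then obtain k where k: "k \<in> borel_measurable lborel" and wk: "AE x in lborel. indicator A x *\<^sub>R w x = k x"
    using completion_ex_borel_measurable_real by blast
  obtain N where N: "N \<in> null_sets lborel" "{x. \<not> indicator A x *\<^sub>R w x = k x} \<subseteq> N"
    using wk by (auto simp: eventually_ae_filter)
  have "N \<times> (UNIV :: 'b set) \<in> null_sets (lborel \<Otimes>\<^sub>M lborel)"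
    using N(1) by (intro lborel.times_in_null_sets1) auto
  then have null: "N \<times> (UNIV :: 'b set) \<in> null_sets lborel"
    by (simp add: lborel_prod)
  have "k \<in> borel_measurable borel"
    using k by simp
  then have "(\<lambda>z :: 'a \<times> 'b. k (fst z) * indicator (A \<times> B) z) \<in> borel_measurable lborel"
    using AB by (auto intro!: borel_measurable_times measurable_compose[OF _ \<open>k \<in> borel_measurable borel\<close>]
      borel_measurable_indicator simp: borel_prod[symmetric])
  moreover have "AE z in lborel. k (fst z) * indicator (A \<times> B) z = indicator (A \<times> B) z *\<^sub>R (case z of (x, y) \<Rightarrow> w x)"
    using AE_not_in[OF null]
  proof eventually_elim
    case (elim z)
    then have "indicator A (fst z) *\<^sub>R w (fst z) = k (fst z)"
      using N(2) by (cases z) auto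
    then show ?case
      by (cases z) (auto simp: indicator_def split: if_splits)
  qed
  ultimately have "(\<lambda>z. indicator (A \<times> B) z *\<^sub>R (case z of (x, y) \<Rightarrow> w x)) \<in> borel_measurable lebesgue"
    by (rule borel_measurable_completion_cong_AE)
  then show ?thesis
    using AB by (subst borel_measurable_restrict_space_iff) auto
qed

section \<open>Continuously differentiable test functions\<close>

lemma C1_functionI:
  assumes "\<And>x. (f has_derivative f' x) (at x)" and "\<And>v. continuous_on UNIV (\<lambda>x. f' x v)"
  shows "C1_function f"
proof -
  have "frechet_derivative f (at x) = f' x" for x
    using frechet_derivative_at[OF assms(1)] by simp
  then show ?thesis
    using assms by (auto simp: C1_function_def differentiable_def)
qed

lemma C1_function_has_derivative:
  "C1_function f \<Longrightarrow> (f has_derivative frechet_derivative f (at x)) (at x)"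
  by (simp add: C1_function_def frechet_derivative_works[symmetric])

lemma C1_function_continuous:
  "C1_function f \<Longrightarrow> continuous_on UNIV f"
  by (auto simp: C1_function_def differentiable_on_def intro!: differentiable_imp_continuous_on)

lemma C1_function_const [simp]: "C1_function (\<lambda>x. c)"
  by (rule C1_functionI[where f' = "\<lambda>x v. 0"]) auto

lemma C1_function_mult:
  assumes f: "C1_function f" and g: "C1_function g"
  shows "C1_function (\<lambda>x. f x * g x)"
proof (rule C1_functionI)
  show "((\<lambda>x. f x * g x) has_derivative
      (\<lambda>v. f x * frechet_derivative g (at x) v + frechet_derivative f (at x) v * g x)) (at x)" for x
    by (intro has_derivative_mult C1_function_has_derivative f g)
  show "continuous_on UNIV (\<lambda>x. f x * frechet_derivative g (at x) v + frechet_derivative f (at x) v * g x)" for v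
    using f g C1_function_continuous[OF f] C1_function_continuous[OF g]
    by (intro continuous_intros) (auto simp: C1_function_def)
qed

lemma C1_function_prod:
  assumes "\<And>i. i \<in> I \<Longrightarrow> C1_function (f i)"
  shows "C1_function (\<lambda>x. \<Prod>i\<in>I. f i x)"
  using assms by (induction I rule: infinite_finite_induct) (auto intro: C1_function_mult)

lemma C1_function_compose:
  assumes \<sigma>: "\<And>y. (\<sigma> has_real_derivative \<sigma>' y) (at y)" and \<sigma>': "continuous_on UNIV \<sigma>'"
    and f: "C1_function f"
  shows "C1_function (\<lambda>x. \<sigma> (f x))"
proof (rule C1_functionI)
  show "((\<lambda>x. \<sigma> (f x)) has_derivative (\<lambda>v. \<sigma>' (f x) * frechet_derivative f (at x) v)) (at x)" for x
    using has_derivative_compose[OF C1_function_has_derivative[OF f] has_field_derivative_imp_has_derivative[OF \<sigma>]]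
    by simp
  have "continuous_on UNIV (\<lambda>x. \<sigma>' (f x))"
    by (rule continuous_on_compose2[OF \<sigma>' C1_function_continuous[OF f]]) auto
  then show "continuous_on UNIV (\<lambda>x. \<sigma>' (f x) * frechet_derivative f (at x) v)" for v
    using f by (intro continuous_intros) (auto simp: C1_function_def)
qed

text \<open>
  For a nonempty box this is a \<open>C\<^sup>1\<close> function whose positivity set is exactly the open box; squaring the
  positive parts makes the first derivatives match at the faces.
\<close>
definition box_bump :: "'a::euclidean_space \<Rightarrow> 'a \<Rightarrow> 'a \<Rightarrow> real" where
  "box_bump a b x = (\<Prod>i\<in>Basis. (max 0 ((x \<bullet> i - a \<bullet> i) * (b \<bullet> i - x \<bullet> i)))\<^sup>2)"

lemma has_real_derivative_max_0_squared:
  "((\<lambda>y::real. (max 0 y)\<^sup>2) has_real_derivative 2 * max 0 y) (at y)"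
proof -
  have "((\<lambda>y. if y \<in> {0..} then y\<^sup>2 else 0) has_vector_derivative (if y \<in> {0..} then 2 * y else 0)) (at y within {0..} \<union> {..0})"
    by (intro has_vector_derivative_If_within_closures)
      (auto intro!: derivative_eq_intros simp: has_real_derivative_iff_has_vector_derivative[symmetric])
  moreover have "{0..} \<union> {..0::real} = UNIV"
    by auto
  moreover have "(\<lambda>y::real. (max 0 y)\<^sup>2) = (\<lambda>y. if y \<in> {0..} then y\<^sup>2 else 0)"
    by (auto simp: max_def fun_eq_iff)
  moreover have "2 * max 0 y = (if y \<in> {0..} then 2 * y else 0)"
    by auto
  ultimately show ?thesis
    by (simp only: has_real_derivative_iff_has_vector_derivative)
qed

lemma C1_function_box_bump: "C1_function (box_bump a b)"
proof -
  have "C1_function (\<lambda>x::'a. (x \<bullet> i - a \<bullet> i) * (b \<bullet> i - x \<bullet> i))" for i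
    by (rule C1_functionI[where f' = "\<lambda>x v. (x \<bullet> i - a \<bullet> i) * (- (v \<bullet> i)) + (v \<bullet> i) * (b \<bullet> i - x \<bullet> i)"])
      (auto intro!: derivative_eq_intros continuous_intros)
  then have "C1_function (\<lambda>x::'a. (max 0 ((x \<bullet> i - a \<bullet> i) * (b \<bullet> i - x \<bullet> i)))\<^sup>2)" for i
    by (rule C1_function_compose[OF has_real_derivative_max_0_squared, rotated])
      (intro continuous_intros)
  then show ?thesis
    unfolding box_bump_def[abs_def] by (intro C1_function_prod)
qed

lemma box_bump_nonneg: "box_bump a b x \<ge> 0"
  by (simp add: box_bump_def prod_nonneg)

lemma box_bump_eq_0_iff:
  assumes "box a b \<noteq> {}"
  shows "box_bump a b x = 0 \<longleftrightarrow> x \<notin> box a b"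
proof -
  have "max 0 ((x \<bullet> i - a \<bullet> i) * (b \<bullet> i - x \<bullet> i)) = 0 \<longleftrightarrow> \<not> (a \<bullet> i < x \<bullet> i \<and> x \<bullet> i < b \<bullet> i)" if "i \<in> Basis" for i
  proof -
    have "a \<bullet> i < b \<bullet> i"
      using assms that by (simp add: box_ne_empty)
    then have "0 < (x \<bullet> i - a \<bullet> i) * (b \<bullet> i - x \<bullet> i) \<longleftrightarrow> a \<bullet> i < x \<bullet> i \<and> x \<bullet> i < b \<bullet> i"
      by (auto simp: zero_less_mult_iff)
    then show ?thesis
      by (auto simp: max_def)
  qed
  then show ?thesis
    by (auto simp: box_bump_def mem_box)
qed

section \<open>The fundamental lemma and weak gradients\<close>

text \<open>
  With \<open>w = box_bump a b\<close>, the test functions \<open>1 - exp (- k w)\<close> increase to the indicator of the open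
  box as \<open>k\<close> grows, and dominated convergence applies.
\<close>
lemma fundamental_lemma_variations_box:
  fixes f :: "'a::euclidean_space \<Rightarrow> real"
  assumes int: "set_integrable lebesgue (cbox a b) f"
    and test: "\<And>\<phi>. C1_function \<phi> \<Longrightarrow> closure {x. \<phi> x \<noteq> 0} \<subseteq> cbox a b \<Longrightarrow>
      (LINT x|lebesgue. f x * \<phi> x) = 0"
  shows "integral (cbox a b) f = 0"
proof (cases "box a b = {}")
  case True
  then show ?thesis
    using integral_open_interval[of a b f] by simp
next
  case False
  define \<phi> where "\<phi> k x = 1 - exp (- (real k * box_bump a b x))" for k x
  \<comment> \<open>\<open>f\<close> is controlled only on the closed box, so the estimates use the truncation \<open>f0\<close>.\<close>
  define f0 where "f0 x = indicator (cbox a b) x * f x" for x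
  have f0 [measurable]: "integrable lebesgue f0"
    using int by (simp add: set_integrable_def f0_def[abs_def])
  have \<phi>_C1: "C1_function (\<phi> k)" for k
    unfolding \<phi>_def
    by (rule C1_function_compose[OF _ _ C1_function_box_bump,
          where \<sigma> = "\<lambda>y. 1 - exp (- (real k * y))" and \<sigma>' = "\<lambda>y. real k * exp (- (real k * y))"])
      (auto intro!: derivative_eq_intros continuous_intros)
  have \<phi>_out: "\<phi> k x = 0" if "x \<notin> box a b" for k x
    using that box_bump_eq_0_iff[OF False] by (simp add: \<phi>_def)
  have \<phi>_bound: "\<bar>\<phi> k x\<bar> \<le> 1" for k x
    using box_bump_nonneg[of a b x] by (simp add: \<phi>_def)
  have \<phi>_lim: "(\<lambda>k. \<phi> k x) \<longlonglongrightarrow> indicator (box a b) x" for x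
  proof (cases "x \<in> box a b")
    case True
    then have "box_bump a b x > 0"
      using box_bump_eq_0_iff[OF False] box_bump_nonneg[of a b x] by (simp add: less_le)
    then have "(\<lambda>k. \<phi> k x) \<longlonglongrightarrow> 1"
      unfolding \<phi>_def by real_asymp
    then show ?thesis
      using True by simp
  qed (simp add: \<phi>_out)
  have f\<phi>: "f x * \<phi> k x = f0 x * \<phi> k x" for k x
    using \<phi>_out[of x k] box_subset_cbox[of a b] by (auto simp: f0_def indicator_def)
  have "closure {x. \<phi> k x \<noteq> 0} \<subseteq> cbox a b" for k
    using \<phi>_out box_subset_cbox[of a b] by (intro closure_minimal) auto
  then have "(LINT x|lebesgue. f0 x * \<phi> k x) = 0" for k
    using test[OF \<phi>_C1] by (simp add: f\<phi>)
  moreover have "(\<lambda>k. LINT x|lebesgue. f0 x * \<phi> k x) \<longlonglongrightarrow> (LINT x|lebesgue. f0 x * indicator (box a b) x)"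
  proof (rule integral_dominated_convergence[where w = "\<lambda>x. \<bar>f0 x\<bar>"])
    have "\<phi> k \<in> borel_measurable borel" for k
      by (intro borel_measurable_continuous_onI C1_function_continuous \<phi>_C1)
    then show "(\<lambda>x. f0 x * \<phi> k x) \<in> borel_measurable lebesgue" for k
      by (intro borel_measurable_times borel_measurable_integrable[OF f0] measurable_completion) simp
    show "AE x in lebesgue. (\<lambda>k. f0 x * \<phi> k x) \<longlonglongrightarrow> f0 x * indicator (box a b) x"
      by (intro always_eventually allI tendsto_mult tendsto_const \<phi>_lim)
    show "AE x in lebesgue. norm (f0 x * \<phi> k x) \<le> \<bar>f0 x\<bar>" for k
      using \<phi>_bound by (auto simp: abs_mult intro!: mult_left_le)
    show "(\<lambda>x. f0 x * indicator (box a b) x) \<in> borel_measurable lebesgue"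
      by (intro borel_measurable_times borel_measurable_integrable[OF f0] borel_measurable_indicator) auto
  qed (use f0 in auto)
  ultimately have "(LINT x|lebesgue. f0 x * indicator (box a b) x) = 0"
    by (simp add: LIMSEQ_const_iff)
  moreover have "f0 x * indicator (box a b) x = indicator (box a b) x *\<^sub>R f x" for x
    using box_subset_cbox[of a b] by (auto simp: f0_def indicator_def)
  ultimately have "(LINT x:box a b|lebesgue. f x) = 0"
    by (simp add: set_lebesgue_integral_def)
  moreover have "set_integrable lebesgue (box a b) f"
    using int by (rule set_integrable_subset) (auto simp: box_subset_cbox)
  ultimately show ?thesis
    using set_lebesgue_integral_eq_integral(2)[of "box a b" f] integral_open_interval[of a b f] by simp
qed

lemma small_cubes_inside_open:
  fixes x :: "'a::euclidean_space"
  assumes "open W" "x \<in> W"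
  shows "\<exists>d>0. \<forall>h. 0 < h \<and> h < d \<longrightarrow> cbox x (x + h *\<^sub>R One) \<subseteq> W"
proof -
  obtain e where e: "e > 0" "ball x e \<subseteq> W"
    using assms by (auto simp: open_contains_ball)
  have "cbox x (x + h *\<^sub>R One) \<subseteq> W" if "0 < h" "h < e / DIM('a)" for h
  proof
    fix y assume "y \<in> cbox x (x + h *\<^sub>R One)"
    then have "\<bar>(y - x) \<bullet> i\<bar> \<le> h" if "i \<in> Basis" for i
      using that by (auto simp: mem_box inner_diff_left inner_add_left)
    then have "norm (y - x) \<le> (\<Sum>i\<in>(Basis :: 'a set). h)"
      using norm_le_l1[of "y - x"] by (meson order_trans sum_mono)
    also have "\<dots> < e"
      using \<open>h < e / DIM('a)\<close> by (simp add: field_simps)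
    finally show "y \<in> W"
      using e by (auto simp: dist_norm norm_minus_commute)
  qed
  then show ?thesis
    using e by (intro exI[of _ "e / DIM('a)"]) auto
qed

text \<open>
  Integrals over all boxes in \<open>V\<close> vanish, and by Lebesgue differentiation \<open>f\<close> is almost everywhere the
  limit of its averages over shrinking cubes.
\<close>
lemma fundamental_lemma_variations:
  fixes f :: "'a::euclidean_space \<Rightarrow> real"
  assumes "open V" and loc: "locally_integrable V f"
    and test: "\<And>\<phi>. C1_function \<phi> \<Longrightarrow> compact (closure {x. \<phi> x \<noteq> 0}) \<Longrightarrow> closure {x. \<phi> x \<noteq> 0} \<subseteq> V \<Longrightarrow>
      (LINT x|lebesgue. f x * \<phi> x) = 0"
  shows "AE x in lebesgue. x \<in> V \<longrightarrow> f x = 0"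
proof -
  have int: "set_integrable lebesgue (cbox a b) f" if "cbox a b \<subseteq> V" for a b
    using loc that by (auto simp: locally_integrable_def)
  have zero: "integral (cbox a b) f = 0" if "cbox a b \<subseteq> V" for a b
    using that by (intro fundamental_lemma_variations_box[OF int] test) (auto simp: compact_eq_bounded_closed intro: bounded_subset[OF bounded_cbox])
  have on_cbox: "AE x in lebesgue. x \<in> cbox a b \<longrightarrow> f x = 0" if ab: "cbox a b \<subseteq> V" for a b
  proof -
    define f0 where "f0 x = indicator (cbox a b) x *\<^sub>R f x" for x
    have "f0 integrable_on UNIV"
      using int[OF ab] by (auto simp: set_integrable_def f0_def[abs_def] intro: integrable_on_lebesgue)
    then have "f0 integrable_on cbox c d" for c d
      by (rule integrable_on_subcbox) auto
    then obtain N where "negligible N"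
      and N: "\<And>x e. x \<notin> N \<Longrightarrow> 0 < e \<Longrightarrow> \<exists>d>0. \<forall>h. 0 < h \<and> h < d \<longrightarrow>
        norm (integral (cbox x (x + h *\<^sub>R One)) f0 /\<^sub>R h ^ DIM('a) - f0 x) < e"
      using integrable_ccontinuous_explicit by blast
    have off_N: "f x = 0" if "x \<in> box a b" "x \<notin> N" for x
    proof (rule ccontr)
      assume "f x \<noteq> 0"
      have x: "x \<in> cbox a b"
        using that box_subset_cbox by blast
      then have "f0 x = f x"
        by (simp add: f0_def)
      obtain d where d: "d > 0" "\<And>h. 0 < h \<Longrightarrow> h < d \<Longrightarrow>
          norm (integral (cbox x (x + h *\<^sub>R One)) f0 /\<^sub>R h ^ DIM('a) - f0 x) < \<bar>f x\<bar>"
        using N[OF \<open>x \<notin> N\<close>, of "\<bar>f x\<bar>"] \<open>f x \<noteq> 0\<close> by auto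
      obtain d' where d': "d' > 0" "\<And>h. 0 < h \<Longrightarrow> h < d' \<Longrightarrow> cbox x (x + h *\<^sub>R One) \<subseteq> box a b"
        using small_cubes_inside_open[OF open_box \<open>x \<in> box a b\<close>] by auto
      define h where "h = min d d' / 2"
      have h: "0 < h" "h < d" "h < d'"
        using d(1) d'(1) by (auto simp: h_def)
      have sub: "cbox x (x + h *\<^sub>R One) \<subseteq> cbox a b"
        using d'(2)[OF h(1,3)] box_subset_cbox by blast
      have "integral (cbox x (x + h *\<^sub>R One)) f0 = integral (cbox x (x + h *\<^sub>R One)) f"
        using sub by (intro integral_cong) (auto simp: f0_def indicator_def)
      also have "\<dots> = 0"
        using sub ab by (intro zero) auto
      finally show False
        using d(2)[OF h(1,2)] \<open>f0 x = f x\<close> by simp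
    qed
    have "AE x in lebesgue. x \<notin> N"
      using \<open>negligible N\<close> by (intro AE_not_in) (simp add: negligible_iff_null_sets)
    moreover have "AE x in lebesgue. x \<notin> cbox a b - box a b"
      by (intro AE_not_in) (simp add: negligible_iff_null_sets[symmetric] negligible_frontier_interval)
    ultimately show ?thesis
      by eventually_elim (use off_N in blast)
  qed
  obtain D where D: "countable D" "D \<subseteq> Pow V" "\<And>X. X \<in> D \<Longrightarrow> \<exists>a b. X = cbox a b" "\<Union>D = V"
    using open_countable_Union_open_cbox[OF \<open>open V\<close>] by metis
  have "AE x in lebesgue. x \<in> X \<longrightarrow> f x = 0" if "X \<in> D" for X
    using D(2,3) that on_cbox by blast
  then have "AE x in lebesgue. \<forall>X\<in>D. x \<in> X \<longrightarrow> f x = 0"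
    using D(1) by (subst AE_ball_countable) auto
  then show ?thesis
    using D(4) by (auto elim!: eventually_mono)
qed

text \<open>
  For a test function supported in \<open>V\<close>, the integrand \<open>v D\<phi>\<close> is identically zero: \<open>v\<close> is zero on \<open>V\<close>, and
  \<open>D\<phi>\<close> is zero outside \<open>V\<close>. So each component of \<open>g\<close> integrates to \<open>0\<close> against all such functions.
\<close>
lemma weak_gradient_vanishes:
  fixes U V :: "(real^'n) set"
  assumes g: "weak_gradient U v g" and "open U" "open V" "V \<subseteq> U" and v: "\<And>x. x \<in> V \<Longrightarrow> v x = 0"
  shows "AE x in lebesgue_on U. x \<in> V \<longrightarrow> g x = 0"
proof -
  have "AE x in lebesgue. x \<in> V \<longrightarrow> g x $ i = 0" for i
  proof (rule fundamental_lemma_variations[OF \<open>open V\<close>])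
    have "set_integrable lebesgue K (\<lambda>x. g x $ i)" if "compact K" "K \<subseteq> V" for K
    proof -
      have "set_integrable lebesgue K g"
        using g that \<open>V \<subseteq> U\<close> by (auto simp: weak_gradient_def locally_integrable_def)
      then show ?thesis
        using integrable_bounded_linear[OF bounded_linear_vec_nth[of i]]
        by (fastforce simp: set_integrable_def)
    qed
    then show "locally_integrable V (\<lambda>x. g x $ i)"
      by (simp add: locally_integrable_def)
    fix \<phi> :: "real^'n \<Rightarrow> real"
    assume \<phi>: "C1_function \<phi>" "compact (closure {x. \<phi> x \<noteq> 0})" "closure {x. \<phi> x \<noteq> 0} \<subseteq> V"
    have "v x * frechet_derivative \<phi> (at x) (axis i 1) = 0" if "x \<in> U" for x
    proof (cases "x \<in> V")
      case False
      then have x: "x \<in> - closure {x. \<phi> x \<noteq> 0}"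
        using \<phi>(3) by auto
      have "(\<phi> has_derivative (\<lambda>v. 0)) (at x)"
        by (rule has_derivative_transform_within_open[OF has_derivative_const[of 0] _ x])
          (use closure_subset[of "{x. \<phi> x \<noteq> 0}"] in auto)
      from frechet_derivative_at[OF this, symmetric] show ?thesis
        by simp
    qed (simp add: v)
    then have "(LINT x|lebesgue_on U. v x * frechet_derivative \<phi> (at x) (axis i 1)) = (LINT x|lebesgue_on U. 0)"
      by (intro Bochner_Integration.integral_cong) auto
    then have "(LINT x|lebesgue_on U. g x $ i * \<phi> x) = 0"
      using g \<phi> \<open>V \<subseteq> U\<close> by (auto simp: weak_gradient_def)
    also have "(LINT x|lebesgue_on U. g x $ i * \<phi> x) = (LINT x|lebesgue. indicator U x *\<^sub>R (g x $ i * \<phi> x))"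
      using \<open>open U\<close> by (intro integral_restrict_space) auto
    also have "\<dots> = (LINT x|lebesgue. g x $ i * \<phi> x)"
    proof (rule Bochner_Integration.integral_cong)
      show "indicator U x *\<^sub>R (g x $ i * \<phi> x) = g x $ i * \<phi> x" for x
        using \<phi>(3) \<open>V \<subseteq> U\<close> closure_subset[of "{x. \<phi> x \<noteq> 0}"] by (auto simp: indicator_def)
    qed simp
    finally show "(LINT x|lebesgue. g x $ i * \<phi> x) = 0" .
  qed
  then have "AE x in lebesgue. \<forall>i. x \<in> V \<longrightarrow> g x $ i = 0"
    unfolding AE_all_countable by blast
  then show ?thesis
    using \<open>open U\<close> by (auto simp: AE_restrict_space_iff vec_eq_iff elim!: eventually_mono)
qed

section \<open>Weighted norms on a time slice\<close>

lemma borel_measurable_lebesgue_on_slices: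
  fixes f :: "'a::euclidean_space \<times> 'b::euclidean_space \<Rightarrow> real"
  assumes f: "f \<in> borel_measurable (lebesgue_on (A \<times> B))"
    and A: "A \<in> sets borel" and B: "B \<in> sets borel"
  shows "AE y in lebesgue_on B. (\<lambda>x. f (x, y)) \<in> borel_measurable (lebesgue_on A)"
proof -
  have "(\<lambda>z. ennreal (f z)) \<in> borel_measurable (lebesgue_on (A \<times> B))"
    and "(\<lambda>z. ennreal (- f z)) \<in> borel_measurable (lebesgue_on (A \<times> B))"
    using f by auto
  from this[THEN Tonelli_lebesgue_on(1)[OF _ A B]] show ?thesis
  proof eventually_elim
    case (elim y)
    then have "(\<lambda>x. enn2real (ennreal (f (x, y))) - enn2real (ennreal (- f (x, y))))
        \<in> borel_measurable (lebesgue_on A)"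
      by (intro borel_measurable_diff borel_measurable_enn2real)
    \<comment> \<open>\<open>ennreal\<close> sends negative numbers to \<open>0\<close>, so this recombines positive and negative parts.\<close>
    moreover have "enn2real (ennreal c) - enn2real (ennreal (- c)) = c" for c
      by (cases "c \<ge> 0") (auto simp: ennreal_neg)
    ultimately show ?case
      by simp
  qed
qed

lemma wnorm_eq_nn_integral:
  assumes [measurable]: "w \<in> borel_measurable (lebesgue_on E)"
      "(\<lambda>x. norm (u x)) \<in> borel_measurable (lebesgue_on E)"
    and w: "\<And>x. x \<in> E \<Longrightarrow> w x \<ge> 0"
  shows "wnorm s w E u = ennpowr (\<integral>\<^sup>+x. ennreal (w x * norm (u x) powr s) \<partial>lebesgue_on E) (1 / s)"
proof -
  have "(\<integral>\<^sup>+x. ennreal (norm (u x) powr s) \<partial>density (lebesgue_on E) (\<lambda>x. ennreal (w x)))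
      = (\<integral>\<^sup>+x. ennreal (w x) * ennreal (norm (u x) powr s) \<partial>lebesgue_on E)"
    by (rule nn_integral_density) measurable
  also have "\<dots> = (\<integral>\<^sup>+x. ennreal (w x * norm (u x) powr s) \<partial>lebesgue_on E)"
    using w by (intro nn_integral_cong) (simp add: ennreal_mult)
  finally show ?thesis
    by (simp add: wnorm_def)
qed

text \<open>
  Hoelder's inequality with \<open>\<theta> = m/r\<close>, the weight being split as \<open>w\<^bsup>\<theta>\<^esup> w\<^bsup>1-\<theta>\<^esup>\<close>.
\<close>
lemma nn_integral_interpolation:
  fixes w :: "'a::euclidean_space \<Rightarrow> real" and v :: "'a \<Rightarrow> 'b::real_normed_vector"
  assumes [measurable]: "w \<in> borel_measurable (lebesgue_on E)" "(\<lambda>x. norm (v x)) \<in> borel_measurable (lebesgue_on E)"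
    and w: "\<And>x. x \<in> E \<Longrightarrow> w x > 0"
    and m: "0 < m" "m < r"
  shows "(\<integral>\<^sup>+x. ennreal (w x * norm (v x) powr (2 + m * (1 - 2 / r))) \<partial>lebesgue_on E)
    \<le> ennpowr (wnorm r w E v) m * ennpowr (wnorm 2 w E v) (2 - 2 * m / r)"
proof -
  have pointwise: "w x * norm (v x) powr (2 + m * (1 - 2 / r))
      = (w x * norm (v x) powr r) powr (m / r) * (w x * norm (v x) powr 2) powr (1 - m / r)"
    if "x \<in> E" for x
  proof -
    have "(w x * norm (v x) powr r) powr (m / r) * (w x * norm (v x) powr 2) powr (1 - m / r)
        = (w x powr (m / r) * w x powr (1 - m / r)) *
          (norm (v x) powr (r * (m / r)) * norm (v x) powr (2 * (1 - m / r)))"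
      using w[OF that] by (simp add: powr_mult powr_powr mult_ac del: powr_numeral)
    also have "w x powr (m / r) * w x powr (1 - m / r) = w x"
      using w[OF that] by (simp add: powr_add[symmetric])
    also have "norm (v x) powr (r * (m / r)) * norm (v x) powr (2 * (1 - m / r))
        = norm (v x) powr (2 + m * (1 - 2 / r))"
      using m by (simp add: powr_add[symmetric] algebra_simps)
    finally show ?thesis ..
  qed
  have "(\<integral>\<^sup>+x. ennreal (w x * norm (v x) powr (2 + m * (1 - 2 / r))) \<partial>lebesgue_on E)
      = (\<integral>\<^sup>+x. ennreal ((w x * norm (v x) powr r) powr (m / r) * (w x * norm (v x) powr 2) powr (1 - m / r))
          \<partial>lebesgue_on E)"
    by (intro nn_integral_cong arg_cong[where f = ennreal] pointwise) simp
  also have "\<dots> \<le> ennpowr (\<integral>\<^sup>+x. ennreal (w x * norm (v x) powr r) \<partial>lebesgue_on E) (m / r) *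
      ennpowr (\<integral>\<^sup>+x. ennreal (w x * norm (v x) powr 2) \<partial>lebesgue_on E) (1 - m / r)"
    using m w by (intro nn_integral_Holder) (auto simp: less_imp_le)
  also have "\<dots> = ennpowr (wnorm r w E v) m * ennpowr (wnorm 2 w E v) (2 - 2 * m / r)"
    using w by (simp add: wnorm_eq_nn_integral less_imp_le ennpowr_ennpowr diff_divide_distrib)
  finally show ?thesis .
qed

text \<open>
  On \<open>S\<close> write \<open>w |g|\<^sup>q = (w f\<^bsup>-q/m\<^esup>) (f\<^bsup>q/m\<^esup> |g|\<^sup>q)\<close> and apply Hoelder's inequality with the exponents
  \<open>m/(m-q)\<close> and \<open>m/q\<close>. Raising to the power \<open>m\<close> leaves the integral of \<open>f |g|\<^sup>m\<close> to the first power, ready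
  to be integrated in a further variable.
\<close>
lemma wnorm_weight_change:
  fixes w f :: "'a::euclidean_space \<Rightarrow> real" and g :: "'a \<Rightarrow> 'b::real_normed_vector"
  assumes [measurable]: "w \<in> borel_measurable (lebesgue_on E)" "f \<in> borel_measurable (lebesgue_on E)"
      "(\<lambda>x. norm (g x)) \<in> borel_measurable (lebesgue_on E)"
      "(indicator S :: 'a \<Rightarrow> real) \<in> borel_measurable (lebesgue_on E)"
    and w: "\<And>x. x \<in> E \<Longrightarrow> w x > 0" and f: "\<And>x. x \<in> E \<Longrightarrow> f x > 0"
    and q: "0 < q" "q < m"
    and S: "AE x in lebesgue_on E. x \<notin> S \<longrightarrow> g x = 0"
  shows "ennpowr (wnorm q w E g) m
    \<le> ennpowr (\<integral>\<^sup>+x. ennreal (w x powr (m / (m - q)) * f x powr (- (q / (m - q))) * indicator S x)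
          \<partial>lebesgue_on E) ((m - q) / q) *
      (\<integral>\<^sup>+x. ennreal (f x * norm (g x) powr m) \<partial>lebesgue_on E)"
    (is "_ \<le> ennpowr ?A _ * ?B")
proof -
  define \<theta> where "\<theta> = (m - q) / m"
  have \<theta>: "0 < \<theta>" "\<theta> < 1" "1 - \<theta> = q / m" "m / (m - q) * \<theta> = 1" "q / (m - q) * \<theta> = q / m"
    using q by (auto simp: \<theta>_def field_simps)
  have pointwise: "w x * norm (g x) powr q
      = (w x powr (m / (m - q)) * f x powr (- (q / (m - q))) * indicator S x) powr \<theta> *
        (f x * norm (g x) powr m) powr (1 - \<theta>)"
    if x: "x \<in> E" and g: "x \<notin> S \<longrightarrow> g x = 0" for x
  proof (cases "x \<in> S")
    case True
    have "(w x powr (m / (m - q)) * f x powr (- (q / (m - q)))) powr \<theta> * (f x * norm (g x) powr m) powr (1 - \<theta>)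
        = w x powr (m / (m - q) * \<theta>) * (f x powr (- (q / (m - q) * \<theta>)) * f x powr (1 - \<theta>)) *
          norm (g x) powr (m * (1 - \<theta>))"
      using w[OF x] f[OF x] by (simp add: powr_mult powr_powr mult_ac)
    also have "\<dots> = w x * norm (g x) powr q"
      using w[OF x] f[OF x] q unfolding \<theta> by (simp add: powr_add[symmetric])
    finally show ?thesis
      using True by simp
  qed (use g in simp)
  have "(\<integral>\<^sup>+x. ennreal (w x * norm (g x) powr q) \<partial>lebesgue_on E)
      = (\<integral>\<^sup>+x. ennreal ((w x powr (m / (m - q)) * f x powr (- (q / (m - q))) * indicator S x) powr \<theta> *
          (f x * norm (g x) powr m) powr (1 - \<theta>)) \<partial>lebesgue_on E)"
    using S AE_space by (intro nn_integral_cong_AE; eventually_elim) (simp add: pointwise)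
  also have "\<dots> \<le> ennpowr ?A \<theta> * ennpowr ?B (1 - \<theta>)"
    using \<theta>(1,2) f by (intro nn_integral_Holder) (auto simp: less_imp_le)
  finally have "ennpowr (wnorm q w E g) m \<le> ennpowr (ennpowr ?A \<theta> * ennpowr ?B (1 - \<theta>)) (m / q)"
    using w q by (simp add: wnorm_eq_nn_integral less_imp_le ennpowr_ennpowr ennpowr_mono)
  also have "\<dots> = ennpowr ?A ((m - q) / q) * ?B"
    using q unfolding \<theta>(3) by (simp add: ennpowr_mult ennpowr_ennpowr \<theta>_def)
  finally show ?thesis .
qed

section \<open>The space-time estimate\<close>

theorem lemma2p3:
  fixes U :: "(real^'n) set"
    and \<gamma>1 \<gamma>2 :: "real^'n \<Rightarrow> real"
    and X :: "(real^'n \<Rightarrow> real) set"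
    and F u :: "(real^'n) \<times> real \<Rightarrow> real"
    and Du :: "(real^'n) \<times> real \<Rightarrow> real^'n"
    and r q c0 m p T :: real
  assumes dim: "CARD('n) \<ge> 2"
    and U: "bounded_C1_domain U"
    and weights: "\<gamma>1 \<in> borel_measurable (lebesgue_on U)" "\<gamma>2 \<in> borel_measurable (lebesgue_on U)"
      "\<forall>x\<in>U. \<gamma>1 x > 0" "\<forall>x\<in>U. \<gamma>2 x > 0"
    and exponents: "r > 2" "r > q" "q \<ge> 1"
    and X: "\<forall>v\<in>X. vanishes_on_boundary U v \<and> (\<exists>g. weak_gradient U v g)"
    and c0: "c0 > 0"
    and ineq: "\<forall>v\<in>X. \<forall>g. weak_gradient U v g \<longrightarrow>
      wnorm r \<gamma>1 U v \<le> ennreal c0 * wnorm q \<gamma>2 U g"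
    and m: "q < m" "m < r"
    and p: "p = 2 + m * (1 - 2 / r)"
    and T: "T > 0"
    and F: "F \<in> borel_measurable (lebesgue_on (spacetime U T))" "\<forall>z\<in>spacetime U T. F z > 0"
    and u: "u \<in> borel_measurable (lebesgue_on (spacetime U T))" "u \<in> spacetime_class X T"
    and Du: "spatial_gradient U T u Du"
  shows "wnorm p (\<lambda>(x, t). \<gamma>1 x) (spacetime U T) u
    \<le> ennreal (c0 powr (m / p)) * ennpowr (Z_const U T m q \<gamma>2 F u) ((m - q) / (p * q)) *
      (esssup (lebesgue_on {0<..<T}) (\<lambda>t. wnorm 2 \<gamma>1 U (\<lambda>x. u (x, t)))
        + wnorm m F (spacetime U T) Du)"
proof -
  define I where "I = {0<..<T}"
  define Q where "Q = spacetime U T"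
  define Z where "Z = Z_const U T m q \<gamma>2 F u"
  define S where "S = esssup (lebesgue_on I) (\<lambda>t. wnorm 2 \<gamma>1 U (\<lambda>x. u (x, t)))"
  define G where "G = wnorm m F Q Du"
  have Q: "Q = U \<times> I"
    by (simp add: Q_def I_def spacetime_def)
  have openU: "open U"
    using U by (simp add: bounded_C1_domain_def)
  have borel: "U \<in> sets borel" "I \<in> sets borel"
    using openU by (auto simp: I_def)
  have mpos: "0 < m" and qpos: "0 < q"
    using exponents(3) m(1) by auto
  have pm: "p - m = 2 - 2 * m / r"
    by (simp add: p algebra_simps)
  moreover have "m / r < 1"
    using mpos m(2) by simp
  ultimately have pm_pos: "0 < p - m" and ppos: "0 < p"
    using mpos by auto
  note [measurable] = weights(1,2)
  have u_meas: "u \<in> borel_measurable (lebesgue_on (U \<times> I))"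
    and F_meas: "F \<in> borel_measurable (lebesgue_on (U \<times> I))"
    and Du_meas: "(\<lambda>z. norm (Du z)) \<in> borel_measurable (lebesgue_on (U \<times> I))"
    using u(1) F(1) Du Q by (auto simp: Q_def spatial_gradient_def)
  define K where "K t = (\<integral>\<^sup>+x. ennreal (\<gamma>1 x * norm (u (x, t)) powr p) \<partial>lebesgue_on U)" for t
  define B where "B t = (\<integral>\<^sup>+x. ennreal (F (x, t) * norm (Du (x, t)) powr m) \<partial>lebesgue_on U)" for t
  \<comment> \<open>All factors of the slice estimate that do not depend on time.\<close>
  define C where "C = ennreal (c0 powr m) * ennpowr Z ((m - q) / q) * ennpowr S (p - m)"

  have slice_estimate: "AE t in lebesgue_on I. K t \<le> C * B t"
  proof -
    have X_slice: "AE t in lebesgue_on I. (\<lambda>x. u (x, t)) \<in> X"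
      using u(2) unfolding spacetime_class_def I_def by blast
    have gradient_slice: "AE t in lebesgue_on I. weak_gradient U (\<lambda>x. u (x, t)) (\<lambda>x. Du (x, t))"
      using Du unfolding spatial_gradient_def I_def by blast
    have Z_slice: "AE t in lebesgue_on I.
        (\<integral>\<^sup>+x. ennreal (\<gamma>2 x powr (m / (m - q)) * F (x, t) powr (- (q / (m - q))) *
          indicator (supp_in Q u) (x, t)) \<partial>lebesgue_on U) \<le> Z"
      unfolding Z_def Z_const_def I_def Q_def by (rule esssup_AE)
    have S_slice: "AE t in lebesgue_on I. wnorm 2 \<gamma>1 U (\<lambda>x. u (x, t)) \<le> S"
      unfolding S_def by (rule esssup_AE)
    show ?thesis
      using X_slice gradient_slice Z_slice S_slice AE_space
        borel_measurable_lebesgue_on_slices[OF u_meas borel]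
        borel_measurable_lebesgue_on_slices[OF F_meas borel]
        borel_measurable_lebesgue_on_slices[OF Du_meas borel]
    proof eventually_elim
      case (elim t)
      note [measurable] = elim(6-8)
      have t: "t \<in> I"
        using elim(5) by simp
      define W where "W = {x. (x, t) \<in> supp_in Q u}"
      \<comment> \<open>\<open>V\<close> is the part of the slice off the space-time support; the gradient vanishes there.\<close>
      define V where "V = U \<inter> (\<lambda>x. (x, t)) -` (- closure {z \<in> Q. u z \<noteq> 0})"
      have "open V"
        unfolding V_def using openU
        by (intro open_Int open_vimage continuous_intros) auto
      have VW: "x \<in> V \<longleftrightarrow> x \<notin> W" if "x \<in> U" for x
        using that t by (auto simp: V_def W_def supp_in_def Q)
      have u0: "u (x, t) = 0" if "x \<in> V" for x
        using that t closure_subset[of "{z \<in> Q. u z \<noteq> 0}"] by (auto simp: V_def Q)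
      have "AE x in lebesgue_on U. x \<in> V \<longrightarrow> Du (x, t) = 0"
        by (rule weak_gradient_vanishes[OF elim(2) openU \<open>open V\<close> _ u0]) (auto simp: V_def)
      then have Du0: "AE x in lebesgue_on U. x \<notin> W \<longrightarrow> Du (x, t) = 0"
        using AE_space by eventually_elim (use VW in auto)
      have "W = U - V"
        using VW t by (auto simp: W_def supp_in_def Q)
      then have W: "W \<in> sets lebesgue"
        using openU \<open>open V\<close> by auto
      have [measurable]: "(indicator W :: _ \<Rightarrow> real) \<in> borel_measurable (lebesgue_on U)"
        using W by (intro measurable_restrict_space1 borel_measurable_indicator)
      have "ennpowr (wnorm q \<gamma>2 U (\<lambda>x. Du (x, t))) m
          \<le> ennpowr (\<integral>\<^sup>+x. ennreal (\<gamma>2 x powr (m / (m - q)) * F (x, t) powr (- (q / (m - q))) * indicator W x)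
              \<partial>lebesgue_on U) ((m - q) / q) * B t"
        unfolding B_def using weights(4) F(2) t qpos m(1) Du0
        by (intro wnorm_weight_change) (auto simp: Q_def[symmetric] Q)
      also have "\<dots> \<le> ennpowr Z ((m - q) / q) * B t"
      proof -
        have "indicator W x = (indicator (supp_in Q u) (x, t) :: real)" for x
          by (simp add: W_def indicator_def)
        then show ?thesis
          using elim(3) m(1) qpos by (intro mult_right_mono ennpowr_mono) auto
      qed
      finally have grad: "ennpowr (wnorm q \<gamma>2 U (\<lambda>x. Du (x, t))) m \<le> ennpowr Z ((m - q) / q) * B t" .
      have "K t \<le> ennpowr (wnorm r \<gamma>1 U (\<lambda>x. u (x, t))) m * ennpowr (wnorm 2 \<gamma>1 U (\<lambda>x. u (x, t))) (p - m)"
        unfolding K_def pm unfolding p using weights(3) mpos m(2)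
        by (intro nn_integral_interpolation) auto
      also have "\<dots> \<le> ennpowr (ennreal c0 * wnorm q \<gamma>2 U (\<lambda>x. Du (x, t))) m * ennpowr S (p - m)"
        using ineq elim(1,2,4) mpos pm_pos by (intro mult_mono ennpowr_mono) auto
      also have "\<dots> \<le> (ennreal (c0 powr m) * (ennpowr Z ((m - q) / q) * B t)) * ennpowr S (p - m)"
        using grad c0 by (auto simp: ennpowr_mult ennpowr_ennreal intro!: mult_right_mono mult_left_mono)
      finally show ?case
        by (simp add: C_def mult_ac)
    qed
  qed

  have \<gamma>1_meas: "(\<lambda>(x, t). \<gamma>1 x) \<in> borel_measurable (lebesgue_on (U \<times> I))"
    using weights(1) borel by (rule borel_measurable_fst_lebesgue_on)
  have "(\<integral>\<^sup>+z. ennreal ((case z of (x, t) \<Rightarrow> \<gamma>1 x) * norm (u z) powr p) \<partial>lebesgue_on Q) = (\<integral>\<^sup>+t. K t \<partial>lebesgue_on I)"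
    unfolding Q K_def using \<gamma>1_meas u_meas borel by (subst Tonelli_lebesgue_on(3)) auto
  also have "\<dots> \<le> (\<integral>\<^sup>+t. C * B t \<partial>lebesgue_on I)"
    using slice_estimate by (rule nn_integral_mono_AE)
  also have "\<dots> = C * (\<integral>\<^sup>+t. B t \<partial>lebesgue_on I)"
    unfolding B_def using F_meas Du_meas borel
    by (intro nn_integral_cmult Tonelli_lebesgue_on(2)) auto
  also have "(\<integral>\<^sup>+t. B t \<partial>lebesgue_on I) = (\<integral>\<^sup>+z. ennreal (F z * norm (Du z) powr m) \<partial>lebesgue_on Q)"
    unfolding Q B_def using F_meas Du_meas borel by (subst Tonelli_lebesgue_on(3)) auto
  also have "\<dots> = ennpowr G m"
    unfolding G_def using F_meas Du_meas F(2) mpos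
    by (subst wnorm_eq_nn_integral) (auto simp: Q Q_def[symmetric] ennpowr_ennpowr less_imp_le)
  finally have "ennpowr (\<integral>\<^sup>+z. ennreal ((case z of (x, t) \<Rightarrow> \<gamma>1 x) * norm (u z) powr p) \<partial>lebesgue_on Q) (1 / p)
      \<le> ennpowr (C * ennpowr G m) (1 / p)"
    using ppos by (intro ennpowr_mono) auto
  also have "ennpowr (\<integral>\<^sup>+z. ennreal ((case z of (x, t) \<Rightarrow> \<gamma>1 x) * norm (u z) powr p) \<partial>lebesgue_on Q) (1 / p)
      = wnorm p (\<lambda>(x, t). \<gamma>1 x) Q u"
    using \<gamma>1_meas u_meas weights(3) by (subst wnorm_eq_nn_integral) (auto simp: Q less_imp_le)
  also have "ennpowr (C * ennpowr G m) (1 / p)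
      = ennreal (c0 powr (m / p)) * ennpowr Z ((m - q) / (p * q)) * (ennpowr S ((p - m) / p) * ennpowr G (m / p))"
    using c0 by (simp add: C_def ennpowr_mult ennpowr_ennpowr ennpowr_ennreal powr_powr mult_ac)
  also have "ennpowr S ((p - m) / p) * ennpowr G (m / p) \<le> ennpowr (S + G) ((p - m) / p) * ennpowr (S + G) (m / p)"
    using ppos pm_pos mpos by (intro mult_mono ennpowr_mono) auto
  also have "\<dots> = S + G"
    using ppos by (simp add: ennpowr_add[symmetric] add_divide_distrib[symmetric])
  finally show ?thesis
    by (simp add: Q_def S_def G_def I_def Z_def mult_left_mono)
qed

end
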